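(* Let $X$ be a real Hilbert space, let $A,B:X\rightrightarrows X$ be maximally monotone, let $T=\operatorname{Id}-J_A+J_BR_A$, and let $x,y\in X$. Then the following hold: (i) $\langle Tx-Ty,x-y\rangle=\|Tx-Ty\|^2+\langle J_Ax-J_Ay,J_{A^{-1}}x-J_{A^{-1}}y\rangle+\langle J_BR_Ax-J_BR_Ay,J_{B^{-1}}R_Ax-J_{B^{-1}}R_Ay\rangle$. (ii) $\langle(\operatorname{Id}-T)x-(\operatorname{Id}-T)y,x-y\rangle=\|(\operatorname{Id}-T)x-(\operatorname{Id}-T)y\|^2+\langle J_Ax-J_Ay,J_{A^{-1}}x-J_{A^{-1}}y\rangle+\langle J_BR_Ax-J_BR_Ay,J_{B^{-1}}R_Ax-J_{B^{-1}}R_Ay\rangle$. (iii) $\|x-y\|^2=\|Tx-Ty\|^2+\|(\operatorname{Id}-T)x-(\operatorname{Id}-T)y\|^2+2\langle J_Ax-J_Ay,J_{A^{-1}}x-J_{A^{-1}}y\rangle+2\langle J_BR_Ax-J_BR_Ay,J_{B^{-1}}R_Ax-J_{B^{-1}}R_Ay\rangle$. (iv) $\|J_Ax-J_Ay\|^2+\|J_{A^{-1}}x-J_{A^{-1}}y\|^2-\|J_ATx-J_ATy\|^2-\|J_{A^{-1}}Tx-J_{A^{-1}}Ty\|^2=\|(\operatorname{Id}-T)x-(\operatorname{Id}-T)y\|^2+2\langle J_ATx-J_ATy,J_{A^{-1}}Tx-J_{A^{-1}}Ty\rangle+2\langle J_BR_Ax-J_BR_Ay,J_{B^{-1}}R_Ax-J_{B^{-1}}R_Ay\rangle$.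 (v) $\|J_ATx-J_ATy\|^2+\|J_{A^{-1}}Tx-J_{A^{-1}}Ty\|^2\le\|J_Ax-J_Ay\|^2+\|J_{A^{-1}}x-J_{A^{-1}}y\|^2$.
   Context: For a maximally monotone operator $C:X\rightrightarrows X$, $J_C=(\operatorname{Id}+C)^{-1}$ is its resolvent and $R_C=2J_C-\operatorname{Id}$ its reflected resolvent, both single-valued maps $X\to X$. $C^{-1}$ is the set-valued inverse, which is again maximally monotone. $T$ is the Douglas--Rachford operator associated with $(A,B)$. *)

theory Defs
  imports "HOL-Analysis.Analysis"
begin

text \<open>
  A real Hilbert space is a type of sort \<open>{real_inner, complete_space}\<close>; a set-valued operator on
  it is a total function \<open>'a \<Rightarrow> 'a set\<close>, where \<open>C x\<close> may be empty.
\<close>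

definition monotone_op :: "('a::real_inner \<Rightarrow> 'a set) \<Rightarrow> bool" where
  "monotone_op C \<longleftrightarrow>
     (\<forall>x y. \<forall>u\<in>C x. \<forall>v\<in>C y. 0 \<le> inner (x - y) (u - v))"

text \<open>Extension of operators is graph inclusion, i.e. pointwise inclusion of the values.\<close>

definition maximally_monotone :: "('a::real_inner \<Rightarrow> 'a set) \<Rightarrow> bool" where
  "maximally_monotone C \<longleftrightarrow>
     monotone_op C \<and> (\<forall>D. monotone_op D \<and> (\<forall>x. C x \<subseteq> D x) \<longrightarrow> D = C)"

definition inverse_op :: "('a \<Rightarrow> 'b set) \<Rightarrow> 'b \<Rightarrow> 'a set" where
  "inverse_op C u = {x. u \<in> C x}"

definition id_plus_op :: "('a::real_inner \<Rightarrow> 'a set) \<Rightarrow> 'a \<Rightarrow> 'a set" where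
  "id_plus_op C x = (\<lambda>u. x + u) ` C x"

text \<open>
  The map \<open>(Id + C)\<^sup>-\<^sup>1\<close> is set-valued. For maximally monotone \<open>C\<close> on a Hilbert space its values are
  singletons (Minty's theorem), and the resolvent picks their elements; for other \<open>C\<close>
  the value may be unspecified.
\<close>

definition resolvent :: "('a::real_inner \<Rightarrow> 'a set) \<Rightarrow> 'a \<Rightarrow> 'a" where
  "resolvent C x = the_elem (inverse_op (id_plus_op C) x)"

definition reflected_resolvent :: "('a::real_inner \<Rightarrow> 'a set) \<Rightarrow> 'a \<Rightarrow> 'a" where
  "reflected_resolvent C x = 2 *\<^sub>R resolvent C x - x"

definition douglas_rachford ::
    "('a::real_inner \<Rightarrow> 'a set) \<Rightarrow> ('a \<Rightarrow> 'a set) \<Rightarrow> 'a \<Rightarrow> 'a" where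
  "douglas_rachford A B x = x - resolvent A x + resolvent B (reflected_resolvent A x)"

end

theory Submission
  imports Defs
begin

text \<open>
  Minty's theorem supplies the decompositions \<open>x = J\<^sub>A x + J\<^bsub>A\<inverse>\<^esub> x\<close> and
  \<open>R\<^sub>A x = J\<^sub>A x - J\<^bsub>A\<inverse>\<^esub> x = J\<^sub>B R\<^sub>A x + J\<^bsub>B\<inverse>\<^esub> R\<^sub>A x\<close>, after which (i)--(iv) are identities between
  inner products and (v) is (iv) with the nonnegative right-hand side dropped. Minty's theorem itself is
  obtained by minimising \<open>F + \<parallel>\<cdot>\<parallel>\<^sup>2 / 2\<close>, where \<open>F\<close> is the Fitzpatrick function of the operator;
  the minimiser exists by completeness, since this function is strongly convex.
\<close>

section \<open>Minimising a closed convex function plus half the squared norm\<close>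

text \<open>
  The set \<open>E\<close> plays the role of the epigraph of a lower semicontinuous convex function \<open>F\<close>; the conclusion says
  that \<open>-z\<close> is a subgradient of \<open>F\<close> at \<open>z\<close>, the optimality condition of \<open>F + \<parallel>\<cdot>\<parallel>\<^sup>2 / 2\<close>.
\<close>

lemma epigraph_proximal_point:
  fixes E :: "('b::{real_inner, complete_space} \<times> real) set"
  assumes "closed E" "convex E" "E \<noteq> {}"
    and bound: "\<And>z t. (z, t) \<in> E \<Longrightarrow> b \<le> t + (norm z)\<^sup>2 / 2"
  shows "\<exists>z t. (z, t) \<in> E \<and> (\<forall>w s. (w, s) \<in> E \<longrightarrow> t - inner z (w - z) \<le> s)"
proof -
  define val where "val e = snd e + (norm (fst e))\<^sup>2 / 2" for e :: "'b \<times> real"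
  define m where "m = Inf (val ` E)"
  have bdd: "bdd_below (val ` E)"
    unfolding val_def using bound by (intro bdd_belowI[of _ b]) fastforce
  have m_le: "m \<le> val e" if "e \<in> E" for e
    unfolding m_def using that bdd by (simp add: cInf_lower)
  have "\<exists>e\<in>E. val e < m + inverse (real (Suc n))" for n
    using cInf_lessD[of "val ` E" "m + inverse (real (Suc n))"] \<open>E \<noteq> {}\<close>
    unfolding m_def by auto
  then obtain e where e: "\<And>n. e n \<in> E" "\<And>n. val (e n) < m + inverse (real (Suc n))"
    by metis
  have "(\<lambda>n. m + inverse (real (Suc n))) \<longlonglongrightarrow> m + 0"
    by (intro tendsto_intros LIMSEQ_inverse_real_of_nat)
  then have val_lim: "(\<lambda>n. val (e n)) \<longlonglongrightarrow> m"
    using e m_le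
    by (intro tendsto_sandwich[of "\<lambda>_. m" "\<lambda>n. val (e n)"]) (auto intro!: always_eventually less_imp_le)
  \<comment> \<open>Parallelogram law: at the midpoint, \<open>val\<close> is the mean of
    \<open>val c\<close> and \<open>val d\<close> minus an eighth of the squared distance of the
    first components, and it is at least \<open>m\<close>.\<close>
  have midpoint: "(norm (fst c - fst d))\<^sup>2 \<le> 4 * (val c - m) + 4 * (val d - m)"
    if "c \<in> E" "d \<in> E" for c d
  proof -
    have "(1/2) *\<^sub>R c + (1/2) *\<^sub>R d \<in> E"
      using \<open>convex E\<close> that by (intro convexD) auto
    from m_le[OF this] show ?thesis
      unfolding val_def
      by (simp add: power2_norm_eq_inner inner_simps inner_commute field_simps)
  qed
  have "Cauchy (\<lambda>n. fst (e n))"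
  proof (rule CauchyI)
    fix r :: real assume "0 < r"
    have "(\<lambda>n. 8 * (val (e n) - m)) \<longlonglongrightarrow> 8 * (m - m)"
      by (intro tendsto_intros val_lim)
    moreover have "8 * (m - m) < r\<^sup>2"
      using \<open>0 < r\<close> by simp
    ultimately have "eventually (\<lambda>n. 8 * (val (e n) - m) < r\<^sup>2) sequentially"
      by (rule order_tendstoD(2))
    then obtain N where N: "\<And>n. n \<ge> N \<Longrightarrow> 8 * (val (e n) - m) < r\<^sup>2"
      unfolding eventually_sequentially by blast
    have "norm (fst (e i) - fst (e j)) < r" if "i \<ge> N" "j \<ge> N" for i j
    proof (rule power2_less_imp_less)
      show "(norm (fst (e i) - fst (e j)))\<^sup>2 < r\<^sup>2"
        using midpoint[OF e(1)[of i] e(1)[of j]] N[OF that(1)] N[OF that(2)]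
        by linarith
    qed (use \<open>0 < r\<close> in simp)
    then show "\<exists>N. \<forall>i\<ge>N. \<forall>j\<ge>N. norm (fst (e i) - fst (e j)) < r" by blast
  qed
  then obtain z where z: "(\<lambda>n. fst (e n)) \<longlonglongrightarrow> z"
    using Cauchy_convergent_iff convergent_def by blast
  \<comment> \<open>As \<open>val (e n)\<close> tends to \<open>m\<close>, this is the limit of the
    heights \<open>snd (e n)\<close>; closedness of \<open>E\<close> then keeps the limit point in
    \<open>E\<close>.\<close>
  define t where "t = m - (norm z)\<^sup>2 / 2"
  have "(\<lambda>n. val (e n) - (norm (fst (e n)))\<^sup>2 / 2) \<longlonglongrightarrow> t"
    unfolding t_def by (intro tendsto_intros val_lim z) simp
  then have "(\<lambda>n. snd (e n)) \<longlonglongrightarrow> t"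
    by (simp add: val_def)
  with z have "e \<longlonglongrightarrow> (z, t)"
    using tendsto_Pair[of "\<lambda>n. fst (e n)" z sequentially "\<lambda>n. snd (e n)" t] by simp
  then have zt: "(z, t) \<in> E"
    using closed_sequentially[OF \<open>closed E\<close>] e(1) by blast
  have "t - inner z (w - z) \<le> s" if ws: "(w, s) \<in> E" for w s
  proof -
    \<comment> \<open>\<open>k\<close> is the one-sided derivative of \<open>val\<close> at
      \<open>(z, t)\<close> along the segment to \<open>(w, s)\<close>. Minimality, divided by the
      step length \<open>l\<close>, gives \<open>0 \<le> k\<close> as \<open>l\<close> tends to 0
      from above.\<close>
    define k where "k = s - t + inner z (w - z)"
    have "0 \<le> k + l * ((norm (w - z))\<^sup>2 / 2)" if l: "0 < l" "l < 1" for l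
    proof -
      have "(1 - l) *\<^sub>R (z, t) + l *\<^sub>R (w, s) \<in> E"
        using \<open>convex E\<close> zt ws l by (intro convexD) auto
      from m_le[OF this] have "m \<le> (1 - l) * t + l * s + (norm ((1 - l) *\<^sub>R z + l *\<^sub>R w))\<^sup>2 / 2"
        by (simp add: val_def)
      moreover have "(1 - l) *\<^sub>R z + l *\<^sub>R w = z + l *\<^sub>R (w - z)"
        by (simp add: algebra_simps)
      moreover have "(norm (z + l *\<^sub>R (w - z)))\<^sup>2
          = (norm z)\<^sup>2 + 2 * l * inner z (w - z) + l * (l * (norm (w - z))\<^sup>2)"
        by (simp add: power2_norm_eq_inner inner_add_left inner_add_right inner_commute[of "w - z" z]
            distrib_left)
      moreover have "m = t + (norm z)\<^sup>2 / 2"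
        by (simp add: t_def)
      ultimately have "t + (norm z)\<^sup>2 / 2 \<le> (1 - l) * t + l * s
          + ((norm z)\<^sup>2 + 2 * l * inner z (w - z) + l * (l * (norm (w - z))\<^sup>2)) / 2"
        by simp
      then have "0 \<le> l * (k + l * ((norm (w - z))\<^sup>2 / 2))"
        unfolding k_def by (simp add: field_simps del: inner_diff_left inner_diff_right)
      then show ?thesis
        using l by (simp add: zero_le_mult_iff)
    qed
    then have "eventually (\<lambda>l. 0 \<le> k + l * ((norm (w - z))\<^sup>2 / 2)) (at_right 0)"
      by (auto simp: eventually_at_right_field intro: exI[of _ 1])
    moreover have "((\<lambda>l. k + l * ((norm (w - z))\<^sup>2 / 2)) \<longlongrightarrow> k + 0 * ((norm (w - z))\<^sup>2 / 2)) (at_right 0)"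
      by (intro tendsto_intros)
    ultimately have "0 \<le> k"
      using tendsto_lowerbound[of _ k "at_right (0::real)" 0] by simp
    then show ?thesis by (simp add: k_def)
  qed
  with zt show ?thesis by blast
qed

section \<open>Minty's theorem via the Fitzpatrick function\<close>

text \<open>If \<open>(p, u)\<close> minimises the Fitzpatrick function plus half the squared norm,
  the subgradient condition forces \<open>(- u, - p) \<in> G\<close> and \<open>u = - p\<close>.
  Maximality enters as \<open>max\<close>: pairs monotonically related to \<open>G\<close> belong to
  \<open>G\<close>.\<close>

lemma Minty_graph:
  fixes G :: "('a::{real_inner, complete_space} \<times> 'a) set"
  assumes mono: "\<And>p u q v. (p, u) \<in> G \<Longrightarrow> (q, v) \<in> G \<Longrightarrow> 0 \<le> inner (p - q) (u - v)"
    and max: "\<And>p u. (\<And>q v. (q, v) \<in> G \<Longrightarrow> 0 \<le> inner (p - q) (u - v)) \<Longrightarrow> (p, u) \<in> G"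
  obtains p where "(p, - p) \<in> G"
proof -
  text \<open>The epigraph of the Fitzpatrick function of \<open>G\<close>.\<close>
  define E where "E = (\<Inter>(q, v)\<in>G. {((p, u), t). inner p v + inner q u - inner q v \<le> t})"
  have E_iff: "((p, u), t) \<in> E \<longleftrightarrow> (\<forall>(q, v)\<in>G. inner p v + inner q u - inner q v \<le> t)" for p u t
    by (auto simp: E_def)
  \<comment> \<open>Monotonicity, rearranged: on \<open>G\<close> the Fitzpatrick function is at
    most the pairing.\<close>
  have G_E: "((q, v), inner q v) \<in> E" if "(q, v) \<in> G" for q v
    unfolding E_iff using mono[OF that] by (fastforce simp: inner_simps inner_commute)
  \<comment> \<open>Were \<open>t\<close> below \<open>inner p u\<close>, \<open>(p, u)\<close>
    would be monotonically related to \<open>G\<close>, hence in \<open>G\<close>, and its own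
    constraint would give \<open>inner p u \<le> t\<close>.\<close>
  have lower: "inner p u \<le> t" if "((p, u), t) \<in> E" for p u t
  proof (rule ccontr)
    assume less: "\<not> inner p u \<le> t"
    have "0 \<le> inner (p - q) (u - v)" if "(q, v) \<in> G" for q v
      using \<open>((p, u), t) \<in> E\<close> that less unfolding E_iff
      by (fastforce simp: inner_simps)
    then have "(p, u) \<in> G" by (rule max)
    with \<open>((p, u), t) \<in> E\<close> less show False
      unfolding E_iff by fastforce
  qed
  have "closed E"
    unfolding E_def case_prod_unfold
    by (intro closed_INT ballI closed_Collect_le continuous_intros)
  moreover have "convex E"
    unfolding E_def
  proof (intro convex_INT, clarsimp)
    fix q v :: 'a
    show "convex {((p, u), t). inner p v + inner q u - inner q v \<le> t}"
    proof (rule convexI, clarsimp)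
      fix p u p' u' :: 'a and t t' k l :: real
      assume *: "inner p v + inner q u - inner q v \<le> t" "inner p' v + inner q u' - inner q v \<le> t'"
        "0 \<le> k" "0 \<le> l" "k + l = 1"
      have "inner q v = k * inner q v + l * inner q v"
        using *(5) by (metis distrib_right mult_1)
      then show "inner (k *\<^sub>R p + l *\<^sub>R p') v + inner q (k *\<^sub>R u + l *\<^sub>R u') - inner q v \<le> k * t + l * t'"
        using mult_left_mono[OF *(1,3)] mult_left_mono[OF *(2,4)]
        by (simp add: inner_simps algebra_simps)
    qed
  qed
  \<comment> \<open>Were \<open>G\<close> empty, \<open>max\<close> would vacuously put
    \<open>(0, 0)\<close> into it.\<close>
  moreover have "E \<noteq> {}"
    using G_E max[of 0 0] by blast
  \<comment> \<open>By \<open>lower\<close>, the objective is at least half the squared norm of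
    \<open>p + u\<close>.\<close>
  moreover have "0 \<le> t + (norm z)\<^sup>2 / 2" if "(z, t) \<in> E" for z t
  proof (cases z)
    case (Pair p u)
    have "0 \<le> inner (p + u) (p + u)" by simp
    then show ?thesis
      using lower[of p u t] that Pair
      by (simp add: power2_norm_eq_inner inner_simps inner_commute field_simps)
  qed
  ultimately have "\<exists>z t. (z, t) \<in> E \<and> (\<forall>w s. (w, s) \<in> E \<longrightarrow> t - inner z (w - z) \<le> s)"
    by (rule epigraph_proximal_point)
  then obtain z t where zt: "(z, t) \<in> E"
    and min: "\<And>w s. (w, s) \<in> E \<Longrightarrow> t - inner z (w - z) \<le> s"
    by blast
  obtain p u where z: "z = (p, u)" by (cases z)
  \<comment> \<open>The subgradient inequality is tested at the points
    \<open>((q, v), inner q v)\<close>, and \<open>t\<close> is bounded below by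
    \<open>inner p u\<close>; the rest is completing the square.\<close>
  have key: "inner (p + u) (p + u) \<le> inner (- u - q) (- p - v)" if "(q, v) \<in> G" for q v
    using min[OF G_E[OF that]] lower[OF zt[unfolded z]]
    unfolding z by (simp add: inner_simps inner_commute)
  have G: "(- u, - p) \<in> G"
    by (rule max) (use key inner_ge_zero order_trans in blast)
  \<comment> \<open>Taking \<open>(q, v) = (- u, - p)\<close> makes the right-hand side of
    \<open>key\<close> vanish.\<close>
  from key[OF G] have "inner (p + u) (p + u) \<le> 0"
    by simp
  then have "p + u = 0"
    using inner_gt_zero_iff[of "p + u"] by linarith
  then have "- u = p"
    by (simp add: add_eq_0_iff2)
  with G show thesis
    using that by blast
qed

text \<open>Adjoining \<open>u\<close> to the value at \<open>p\<close> keeps the operator monotone,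
  so maximality makes this extension trivial. This is the form of maximality that
  \<open>Minty_graph\<close> takes.\<close>

lemma maximally_monotoneD:
  assumes "maximally_monotone C" "\<And>q v. v \<in> C q \<Longrightarrow> 0 \<le> inner (p - q) (u - v)"
  shows "u \<in> C p"
proof -
  define D where "D = C(p := insert u (C p))"
  have "monotone_op C" and C: "\<And>D. monotone_op D \<Longrightarrow> (\<And>x. C x \<subseteq> D x) \<Longrightarrow> D = C"
    using assms(1) by (auto simp: maximally_monotone_def)
  have sym: "0 \<le> inner (q - p) (v - u)" if "v \<in> C q" for q v
    using assms(2)[OF that] by (metis inner_minus_left inner_minus_right minus_diff_eq minus_minus)
  have "monotone_op D"
    using \<open>monotone_op C\<close> assms(2) sym
    by (auto simp: monotone_op_def D_def split: if_splits)
  then have "D = C"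
    by (rule C) (auto simp: D_def)
  then show ?thesis
    by (metis D_def fun_upd_same insertI1)
qed

text \<open>Existence is \<open>Minty_graph\<close> for the graph of \<open>C\<close> shifted by
  \<open>- x\<close> in the second component. For two solutions, monotonicity bounds the squared
  norm of their difference by 0.\<close>

theorem Minty:
  fixes C :: "'a::{real_inner, complete_space} \<Rightarrow> 'a set"
  assumes "maximally_monotone C"
  shows "\<exists>!p. x - p \<in> C p"
proof -
  have mono: "0 \<le> inner (p - q) (u - v)" if "u \<in> C p" "v \<in> C q" for p q u v
    using assms that by (auto simp: maximally_monotone_def monotone_op_def)
  obtain p where "(p, - p) \<in> {(q, v). v + x \<in> C q}"
  proof (rule Minty_graph)
    show "0 \<le> inner (p - q) (u - v)"
      if "(p, u) \<in> {(q, v). v + x \<in> C q}" "(q, v) \<in> {(q, v). v + x \<in> C q}" for p u q v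
      using mono[of "u + x" p "v + x" q] that by simp
    show "(p, u) \<in> {(q, v). v + x \<in> C q}"
      if *: "\<And>q v. (q, v) \<in> {(q, v). v + x \<in> C q} \<Longrightarrow> 0 \<le> inner (p - q) (u - v)" for p u
    proof -
      have "0 \<le> inner (p - q) ((u + x) - v)" if "v \<in> C q" for q v
        using *[of q "v - x"] that by (simp add: algebra_simps)
      from maximally_monotoneD[OF assms this] show ?thesis by simp
    qed
  qed
  then have "x - p \<in> C p" by simp
  moreover have "p = q" if "x - p \<in> C p" "x - q \<in> C q" for p q
  proof -
    have "0 \<le> inner (p - q) (- (p - q))"
      using mono[OF that] by simp
    then have "inner (p - q) (p - q) \<le> 0"
      unfolding inner_minus_right by linarith
    then have "p - q = 0"
      using inner_gt_zero_iff[of "p - q"] by linarith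
    then show ?thesis by simp
  qed
  ultimately show ?thesis by blast
qed

section \<open>Resolvents of an operator and of its inverse\<close>

lemma resolvent_eqI:
  assumes "\<exists>!p. x - p \<in> C p" "x - p \<in> C p"
  shows "resolvent C x = p"
proof -
  have "inverse_op (id_plus_op C) x = {q. x - q \<in> C q}"
    by (force simp: inverse_op_def id_plus_op_def image_iff)
  also have "\<dots> = {p}" using assms by blast
  finally show ?thesis by (simp add: resolvent_def)
qed

lemma resolvent_mem:
  fixes C :: "'a::{real_inner, complete_space} \<Rightarrow> 'a set"
  assumes "maximally_monotone C"
  shows "x - resolvent C x \<in> C (resolvent C x)"
  using Minty[OF assms, of x] resolvent_eqI[of x C] by metis

text \<open>The map taking \<open>p\<close> to \<open>x - p\<close> exchanges the solutions of
  \<open>x - p \<in> C p\<close> with those for \<open>inverse_op C\<close>, so unique solvability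
  carries over from \<open>Minty\<close>.\<close>

lemma resolvent_inverse_op:
  fixes C :: "'a::{real_inner, complete_space} \<Rightarrow> 'a set"
  assumes "maximally_monotone C"
  shows "resolvent (inverse_op C) x = x - resolvent C x"
proof (rule resolvent_eqI)
  show "x - (x - resolvent C x) \<in> inverse_op C (x - resolvent C x)"
    using resolvent_mem[OF assms, of x] by (simp add: inverse_op_def)
  then show "\<exists>!p. x - p \<in> inverse_op C p"
  proof (rule ex1I)
    fix p assume "x - p \<in> inverse_op C p"
    then have "x - (x - p) \<in> C (x - p)"
      by (simp add: inverse_op_def)
    with resolvent_mem[OF assms, of x] have "x - p = resolvent C x"
      using Minty[OF assms, of x] by blast
    then show "p = x - resolvent C x"
      by (simp add: algebra_simps)
  qed
qed

text \<open>The pair of \<open>resolvent C x\<close> and \<open>x - resolvent C x\<close> lies in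
  the graph of \<open>C\<close>, so this is monotonicity of \<open>C\<close> at two such
  pairs.\<close>

lemma resolvent_firmly_nonexpansive:
  fixes C :: "'a::{real_inner, complete_space} \<Rightarrow> 'a set"
  assumes "maximally_monotone C"
  shows "0 \<le> inner (resolvent C x - resolvent C y)
                (resolvent (inverse_op C) x - resolvent (inverse_op C) y)"
  using assms resolvent_mem[OF assms]
  by (simp add: resolvent_inverse_op[OF assms] maximally_monotone_def monotone_op_def)

section \<open>The Douglas--Rachford identities\<close>

theorem theorem2p7:
  fixes A B :: "'a::{real_inner, complete_space} \<Rightarrow> 'a set"
    and T :: "'a \<Rightarrow> 'a" and x y :: 'a
  assumes "maximally_monotone A" and "maximally_monotone B"
    and "T = douglas_rachford A B"
  shows
    "(inner (T x - T y) (x - y) =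
           (norm (T x - T y))\<^sup>2
         + inner (resolvent A x - resolvent A y)
               (resolvent (inverse_op A) x - resolvent (inverse_op A) y)
         + inner (resolvent B (reflected_resolvent A x) - resolvent B (reflected_resolvent A y))
               (resolvent (inverse_op B) (reflected_resolvent A x) - resolvent (inverse_op B) (reflected_resolvent A y))) \<and>
     (inner ((x - T x) - (y - T y)) (x - y) =
           (norm ((x - T x) - (y - T y)))\<^sup>2
         + inner (resolvent A x - resolvent A y)
               (resolvent (inverse_op A) x - resolvent (inverse_op A) y)
         + inner (resolvent B (reflected_resolvent A x) - resolvent B (reflected_resolvent A y))
               (resolvent (inverse_op B) (reflected_resolvent A x) - resolvent (inverse_op B) (reflected_resolvent A y))) \<and>
     ((norm (x - y))\<^sup>2 =
           (norm (T x - T y))\<^sup>2 + (norm ((x - T x) - (y - T y)))\<^sup>2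
         + 2 * inner (resolvent A x - resolvent A y)
               (resolvent (inverse_op A) x - resolvent (inverse_op A) y)
         + 2 * inner (resolvent B (reflected_resolvent A x) - resolvent B (reflected_resolvent A y))
               (resolvent (inverse_op B) (reflected_resolvent A x) - resolvent (inverse_op B) (reflected_resolvent A y))) \<and>
     ((norm (resolvent A x - resolvent A y))\<^sup>2 + (norm (resolvent (inverse_op A) x - resolvent (inverse_op A) y))\<^sup>2
         - (norm (resolvent A (T x) - resolvent A (T y)))\<^sup>2 - (norm (resolvent (inverse_op A) (T x) - resolvent (inverse_op A) (T y)))\<^sup>2 =
           (norm ((x - T x) - (y - T y)))\<^sup>2
         + 2 * inner (resolvent A (T x) - resolvent A (T y))
               (resolvent (inverse_op A) (T x) - resolvent (inverse_op A) (T y))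
         + 2 * inner (resolvent B (reflected_resolvent A x) - resolvent B (reflected_resolvent A y))
               (resolvent (inverse_op B) (reflected_resolvent A x) - resolvent (inverse_op B) (reflected_resolvent A y))) \<and>
     ((norm (resolvent A (T x) - resolvent A (T y)))\<^sup>2 + (norm (resolvent (inverse_op A) (T x) - resolvent (inverse_op A) (T y)))\<^sup>2
         \<le> (norm (resolvent A x - resolvent A y))\<^sup>2 + (norm (resolvent (inverse_op A) x - resolvent (inverse_op A) y))\<^sup>2)"
proof -
  note A = assms(1) and B = assms(2)
  note JA' = resolvent_inverse_op[OF A] and JB' = resolvent_inverse_op[OF B]
  have split_A: "(norm (s - t))\<^sup>2 = (norm (resolvent A s - resolvent A t))\<^sup>2
      + (norm (resolvent (inverse_op A) s - resolvent (inverse_op A) t))\<^sup>2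
      + 2 * inner (resolvent A s - resolvent A t)
          (resolvent (inverse_op A) s - resolvent (inverse_op A) t)" for s t
    unfolding JA' by (simp add: power2_norm_eq_inner inner_simps inner_commute)
  define a where "a = resolvent A x - resolvent A y"
  define a' where "a' = resolvent (inverse_op A) x - resolvent (inverse_op A) y"
  define b where "b = resolvent B (reflected_resolvent A x) - resolvent B (reflected_resolvent A y)"
  define b' where "b' = resolvent (inverse_op B) (reflected_resolvent A x)
    - resolvent (inverse_op B) (reflected_resolvent A y)"
  have xy: "x - y = a + a'"
    by (simp add: a_def a'_def JA')
  have Txy: "T x - T y = a' + b" and Sxy: "(x - T x) - (y - T y) = a - b"
    by (simp_all add: assms(3) douglas_rachford_def a_def a'_def b_def JA')
  \<comment> \<open>Every difference is now a combination of \<open>a\<close>, \<open>a'\<close> and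
    \<open>b\<close>, so the first three identities follow by bilinear expansion.\<close>
  have b': "b' = a - a' - b"
    by (simp add: b'_def b_def a_def a'_def JA' JB' reflected_resolvent_def scaleR_2)
  have i: "inner (T x - T y) (x - y) = (norm (T x - T y))\<^sup>2 + inner a a' + inner b b'"
    and ii: "inner ((x - T x) - (y - T y)) (x - y)
      = (norm ((x - T x) - (y - T y)))\<^sup>2 + inner a a' + inner b b'"
    unfolding Sxy xy Txy b' by (simp_all add: power2_norm_eq_inner inner_simps inner_commute)
  have iii: "(norm (x - y))\<^sup>2 = (norm (T x - T y))\<^sup>2 + (norm ((x - T x) - (y - T y)))\<^sup>2
      + 2 * inner a a' + 2 * inner b b'"
    unfolding Sxy xy Txy b' by (simp add: power2_norm_eq_inner inner_simps inner_commute)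
  have iv: "(norm a)\<^sup>2 + (norm a')\<^sup>2 - (norm (resolvent A (T x) - resolvent A (T y)))\<^sup>2
      - (norm (resolvent (inverse_op A) (T x) - resolvent (inverse_op A) (T y)))\<^sup>2
    = (norm ((x - T x) - (y - T y)))\<^sup>2
      + 2 * inner (resolvent A (T x) - resolvent A (T y))
          (resolvent (inverse_op A) (T x) - resolvent (inverse_op A) (T y))
      + 2 * inner b b'"
    \<comment> \<open>Expanding both squared distances in \<open>iii\<close> by
      \<open>split_A\<close> cancels \<open>2 * inner a a'\<close> and brings in the resolvents at
      \<open>T x\<close> and \<open>T y\<close>.\<close>
    using iii split_A[of x y, folded a_def a'_def] split_A[of "T x" "T y"] by linarith
  have "0 \<le> inner b b'"
    unfolding b_def b'_def by (rule resolvent_firmly_nonexpansive[OF B])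
  then have v: "(norm (resolvent A (T x) - resolvent A (T y)))\<^sup>2
      + (norm (resolvent (inverse_op A) (T x) - resolvent (inverse_op A) (T y)))\<^sup>2
    \<le> (norm a)\<^sup>2 + (norm a')\<^sup>2"
    using iv resolvent_firmly_nonexpansive[OF A, of "T x" "T y"]
      zero_le_power2[of "norm ((x - T x) - (y - T y))"] by linarith
  show ?thesis
    using i ii iii iv v unfolding a_def a'_def b_def b'_def by (intro conjI)
qed

end
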